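(* For every Natural Deduction derivation $\Pi$ in $M_{\supset}$ of $\alpha$ from $\Gamma$ that uses only greedy $\supset$-introduction rules and $\supset$-elimination rules, there is a decorated greedy tree-like derivation $\Pi_T$ of $\alpha$ from $\Gamma$.
   Context: $M_{\supset}$ is the purely implicational fragment of propositional minimal logic with Natural Deduction rules $\supset$-introduction and $\supset$-elimination. A derivation of $\alpha$ from $\Gamma$ has conclusion $\alpha$ and set of open assumptions $\Gamma$. A $\supset$-introduction concluding $\alpha\supset\beta$ from $\beta$ is greedy if it discharges every open occurrence of $\alpha$ on which the premiss $\beta$ depends; a formula occurrence depends on the open assumptions of the subderivation ending in it. A tree-like derivation is a structure $\langle V,E_D,E_d,r,l\rangle$ with $E_D,E_d\subseteq V\times V$, $\langle V,E_D,r\rangle$ a rooted directed acyclic connected graph with $r$ the unique node of out-degree $0$, and $l$ a labelling of nodes by $M_{\supset}$ formulas, such that: every $v\neq r$ has $E_D$-in-degree $0,1$ or $2$; if $v$ has $E_D$-in-degree $1$ with $E_D(w,v)$ then $l(v)=l(v_d)\supset l(w)$ for every $v_d$ with $E_d(v_d,v)$; if $E_d(v_d,v)$ then there is an $E_D$-path from $v_d$ to $v$ and $v_d$ has $E_D$-in-degree $0$; if $v$ has $E_D$-in-degree $2$ then its two $E_D$-predecessors $w_1,w_2$ satisfy $l(w_2)=l(w_1)\supset l(v)$. (Nodes are formula occurrences, $E_D$ goes from premisses to conclusions, $E_d$ from discharged assumptions to the conclusion of the discharging $\supset$-introduction.) Its conclusion is $l(r)$; its assumptions are the labels of $E_D$-in-degree-$0$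 nodes that are not the source of an $E_d$-edge; it is a derivation of $\alpha$ from $\Gamma$ if $l(r)=\alpha$ and its set of assumptions is $\Gamma$. Fix a linear order $\mathcal{O}_S$ on the set $S$ of formulas in the range of $l$; bitstrings over $\mathcal{O}_S=\beta_0,\dots,\beta_k$ are strings $b_0\cdots b_k\in\{0,1\}^{k+1}$ with $Set(b_0\cdots b_k)=\{\beta_i:b_i=1\}$. A decorated greedy tree-like derivation (DGTD) is a tuple $\langle V,E_D,E_d,r,l,L\rangle$ where $\langle V,E_D,E_d,r,l\rangle$ is a tree-like derivation in which every $\supset$-introduction is greedy, and $L$ maps each edge of $E_D$ to a bitstring over $\mathcal{O}_S$ such that for every $\langle v_1,v_2\rangle\in E_D$, $Set(L(\langle v_1,v_2\rangle))$ is the set of formulas on which the formula occurrence $l(v_1)$ depends. *)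

theory Defs
  imports Main
begin

datatype 'p form = Var 'p | Imp "'p form" "'p form"  (infixr "\<^bold>\<rightarrow>" 60)

subsection \<open>Natural Deduction derivations\<close>

text \<open>
  Assumption occurrences carry a discharge marker, so that an introduction may discharge
  all, some or none of the open occurrences of a formula. In \<open>ImpI m \<alpha> \<beta> D\<close> the
  introduction concludes \<open>\<alpha> \<^bold>\<rightarrow> \<beta>\<close> and discharges the open occurrences of \<open>\<alpha>\<close> marked
  \<open>m\<close>. In \<open>ImpE \<beta> D E\<close> the conclusion is \<open>\<beta>\<close>, \<open>D\<close> derives the minor
  and \<open>E\<close> the major premiss. Correctness of the rule applications is imposed by \<open>nd_correct\<close>.
\<close>

datatype 'p nd =
    Assm nat "'p form"
  | ImpI nat "'p form" "'p form" "'p nd"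
  | ImpE "'p form" "'p nd" "'p nd"

fun concl :: "'p nd \<Rightarrow> 'p form" where
  "concl (Assm m \<alpha>) = \<alpha>"
| "concl (ImpI m \<alpha> \<beta> D) = \<alpha> \<^bold>\<rightarrow> \<beta>"
| "concl (ImpE \<beta> D E) = \<beta>"

fun nd_correct :: "'p nd \<Rightarrow> bool" where
  "nd_correct (Assm m \<alpha>) \<longleftrightarrow> True"
| "nd_correct (ImpI m \<alpha> \<beta> D) \<longleftrightarrow> nd_correct D \<and> concl D = \<beta>"
| "nd_correct (ImpE \<beta> D E) \<longleftrightarrow> nd_correct D \<and> nd_correct E \<and> concl E = concl D \<^bold>\<rightarrow> \<beta>"

fun open_marked :: "'p nd \<Rightarrow> (nat \<times> 'p form) set" where
  "open_marked (Assm m \<alpha>) = {(m, \<alpha>)}"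
| "open_marked (ImpI m \<alpha> \<beta> D) = open_marked D - {(m, \<alpha>)}"
| "open_marked (ImpE \<beta> D E) = open_marked D \<union> open_marked E"

definition nd_derivation_of :: "'p nd \<Rightarrow> 'p form \<Rightarrow> 'p form set \<Rightarrow> bool" where
  "nd_derivation_of D \<alpha> \<Gamma> \<longleftrightarrow> nd_correct D \<and> concl D = \<alpha> \<and> snd ` open_marked D = \<Gamma>"

fun nd_greedy :: "'p nd \<Rightarrow> bool" where
  "nd_greedy (Assm m \<alpha>) \<longleftrightarrow> True"
| "nd_greedy (ImpI m \<alpha> \<beta> D) \<longleftrightarrow>
     nd_greedy D \<and> (\<forall>m'. (m', \<alpha>) \<in> open_marked D \<longrightarrow> m' = m)"
| "nd_greedy (ImpE \<beta> D E) \<longleftrightarrow> nd_greedy D \<and> nd_greedy E"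

subsection \<open>Tree-like derivations\<close>

text \<open>
  \<open>ded\<close> and \<open>dis\<close> are the edge relations \<open>E_D\<close> (from premisses to conclusions) and
  \<open>E_d\<close> (from discharged assumptions to the conclusion of the discharging introduction).
\<close>

record ('v, 'p) tree_deriv =
  nodes :: "'v set"
  ded :: "('v \<times> 'v) set"
  dis :: "('v \<times> 'v) set"
  root :: 'v
  lbl :: "'v \<Rightarrow> 'p form"

definition indeg :: "('v, 'p) tree_deriv \<Rightarrow> 'v \<Rightarrow> nat" where
  "indeg T v = card {w. (w, v) \<in> ded T}"

definition outdeg :: "('v, 'p) tree_deriv \<Rightarrow> 'v \<Rightarrow> nat" where
  "outdeg T v = card {w. (v, w) \<in> ded T}"

text \<open>
  The graph is a finite tree directed towards its root, so no node has two conclusions. The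
  degree and rule conditions apply to the root as well. A node of in-degree 1 is labelled by an
  implication even when nothing is discharged there, and only such nodes are targets of
  discharge edges. Without these conditions the structure would admit unsound derivations.
\<close>

definition tree_like :: "('v, 'p) tree_deriv \<Rightarrow> bool" where
  "tree_like T \<longleftrightarrow>
     finite (nodes T) \<and>
     ded T \<subseteq> nodes T \<times> nodes T \<and>
     dis T \<subseteq> nodes T \<times> nodes T \<and>
     root T \<in> nodes T \<and>
     acyclic (ded T) \<and>
     (\<forall>u \<in> nodes T. \<forall>v \<in> nodes T. (u, v) \<in> (ded T \<union> (ded T)\<inverse>)\<^sup>*) \<and>
     (\<forall>v \<in> nodes T. outdeg T v = 0 \<longleftrightarrow> v = root T) \<and>
     (\<forall>v \<in> nodes T. outdeg T v \<le> 1) \<and>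
     (\<forall>v \<in> nodes T. indeg T v \<in> {0, 1, 2}) \<and>
     (\<forall>v \<in> nodes T. indeg T v = 1 \<longrightarrow>
        (\<forall>w. (w, v) \<in> ded T \<longrightarrow>
           (\<exists>\<alpha>. lbl T v = \<alpha> \<^bold>\<rightarrow> lbl T w \<and> (\<forall>u. (u, v) \<in> dis T \<longrightarrow> lbl T u = \<alpha>)))) \<and>
     (\<forall>u v. (u, v) \<in> dis T \<longrightarrow> (u, v) \<in> (ded T)\<^sup>+ \<and> indeg T u = 0 \<and> indeg T v = 1) \<and>
     (\<forall>v \<in> nodes T. indeg T v = 2 \<longrightarrow>
        (\<exists>w1 w2. {w. (w, v) \<in> ded T} = {w1, w2} \<and> lbl T w2 = lbl T w1 \<^bold>\<rightarrow> lbl T v))"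

definition tree_assumptions :: "('v, 'p) tree_deriv \<Rightarrow> 'p form set" where
  "tree_assumptions T = lbl T ` {u \<in> nodes T. indeg T u = 0 \<and> (\<nexists>v. (u, v) \<in> dis T)}"

definition tree_derivation_of ::
    "('v, 'p) tree_deriv \<Rightarrow> 'p form \<Rightarrow> 'p form set \<Rightarrow> bool" where
  "tree_derivation_of T \<alpha> \<Gamma> \<longleftrightarrow> tree_like T \<and> lbl T (root T) = \<alpha> \<and> tree_assumptions T = \<Gamma>"

definition subtree :: "('v, 'p) tree_deriv \<Rightarrow> 'v \<Rightarrow> 'v set" where
  "subtree T v = {u \<in> nodes T. (u, v) \<in> (ded T)\<^sup>*}"

definition open_occs :: "('v, 'p) tree_deriv \<Rightarrow> 'v \<Rightarrow> 'v set" where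
  "open_occs T v =
     {u \<in> subtree T v. indeg T u = 0 \<and> (\<nexists>w. w \<in> subtree T v \<and> (u, w) \<in> dis T)}"

definition depends :: "('v, 'p) tree_deriv \<Rightarrow> 'v \<Rightarrow> 'p form set" where
  "depends T v = lbl T ` open_occs T v"

definition tree_greedy :: "('v, 'p) tree_deriv \<Rightarrow> bool" where
  "tree_greedy T \<longleftrightarrow>
     (\<forall>v \<in> nodes T. \<forall>w \<alpha>. indeg T v = 1 \<and> (w, v) \<in> ded T \<and> lbl T v = \<alpha> \<^bold>\<rightarrow> lbl T w \<longrightarrow>
        (\<forall>u \<in> open_occs T w. lbl T u = \<alpha> \<longrightarrow> (u, v) \<in> dis T))"

subsection \<open>Decorations\<close>

text \<open>A linear order on a finite set is given by its increasing enumeration.\<close>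

definition linear_order_of :: "'a list \<Rightarrow> 'a set \<Rightarrow> bool" where
  "linear_order_of \<beta>s S \<longleftrightarrow> distinct \<beta>s \<and> set \<beta>s = S"

definition bits_set :: "'a list \<Rightarrow> bool list \<Rightarrow> 'a set" where
  "bits_set \<beta>s b = {\<beta>s ! i | i. i < length \<beta>s \<and> b ! i}"

text \<open>Only the values of \<open>L\<close> on the edges in \<open>ded T\<close> matter.\<close>

definition dgtd ::
    "'p form list \<Rightarrow> ('v, 'p) tree_deriv \<Rightarrow> ('v \<times> 'v \<Rightarrow> bool list) \<Rightarrow> bool" where
  "dgtd \<beta>s T L \<longleftrightarrow>
     tree_like T \<and> tree_greedy T \<and> linear_order_of \<beta>s (lbl T ` nodes T) \<and>
     (\<forall>(v1, v2) \<in> ded T.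
        length (L (v1, v2)) = length \<beta>s \<and> bits_set \<beta>s (L (v1, v2)) = depends T v1)"

end

(* The nodes of the tree are the positions of the derivation, i.e. the paths from its conclusion
   to the formula occurrences. A position u is discharged at v exactly if the leaf at u is still
   open in the premiss of the introduction at v and carries the formula and marker discharged
   there. Since this is stable under passing to a subderivation, the open occurrences above a node
   are the open leaves of the subderivation at that position, so the dependency sets of the tree
   are those of the derivation and greediness carries over. *)

theory Submission
  imports Defs "HOL-Library.Countable"
begin

section \<open>Positions of a derivation\<close>

fun positions :: "'p nd \<Rightarrow> bool list set" where
  "positions (Assm m \<alpha>) = {[]}"
| "positions (ImpI m \<alpha> \<beta> D) = insert [] ((#) False ` positions D)"
| "positions (ImpE \<beta> D E) = insert [] ((#) False ` positions D \<union> (#) True ` positions E)"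

text \<open>Outside \<open>positions D\<close> the value of \<open>subderiv D\<close> is junk.\<close>

fun subderiv :: "'p nd \<Rightarrow> bool list \<Rightarrow> 'p nd" where
  "subderiv D [] = D"
| "subderiv (Assm m \<alpha>) (b # p) = Assm m \<alpha>"
| "subderiv (ImpI m \<alpha> \<beta> D) (b # p) = subderiv D p"
| "subderiv (ImpE \<beta> D E) (b # p) = subderiv (if b then E else D) p"

lemma Nil_in_positions [simp]: "[] \<in> positions D"
  by (cases D) auto

lemma finite_positions [simp]: "finite (positions D)"
  by (induction D) auto

lemma subderiv_append:
  "p \<in> positions D \<Longrightarrow> subderiv D (p @ q) = subderiv (subderiv D p) q"
  by (induction D arbitrary: p) auto

text \<open>Serves twice: it makes positions closed under prefixes, and it reduces membership above
  \<open>p\<close> to the subderivation at \<open>p\<close>. The first conjunct on the right keeps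
  out the junk values of \<open>subderiv\<close>.\<close>

lemma append_in_positions_iff:
  "p @ q \<in> positions D \<longleftrightarrow> p \<in> positions D \<and> q \<in> positions (subderiv D p)"
proof (induction D arbitrary: p)
  case (Assm m \<alpha>)
  then show ?case by (cases p) auto
next
  case (ImpI m \<alpha> \<beta> D)
  then show ?case by (cases p) auto
next
  case (ImpE \<beta> D E)
  then show ?case by (cases p) auto
qed

lemma nd_correct_subderiv:
  "nd_correct D \<Longrightarrow> p \<in> positions D \<Longrightarrow> nd_correct (subderiv D p)"
  by (induction D arbitrary: p) auto

lemma nd_greedy_subderiv:
  "nd_greedy D \<Longrightarrow> p \<in> positions D \<Longrightarrow> nd_greedy (subderiv D p)"
  by (induction D arbitrary: p) auto

section \<open>Open leaves and discharge\<close>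

fun is_assm :: "'p nd \<Rightarrow> bool" where
  "is_assm (Assm m \<alpha>) \<longleftrightarrow> True"
| "is_assm (ImpI m \<alpha> \<beta> D) \<longleftrightarrow> False"
| "is_assm (ImpE \<beta> D E) \<longleftrightarrow> False"

text \<open>Refines \<open>open_marked\<close> from marked formulas to occurrences: distinct leaves
  with the same marker and formula stay distinct.\<close>

fun open_leaves :: "'p nd \<Rightarrow> bool list set" where
  "open_leaves (Assm m \<alpha>) = {[]}"
| "open_leaves (ImpI m \<alpha> \<beta> D) = (#) False ` {w \<in> open_leaves D. subderiv D w \<noteq> Assm m \<alpha>}"
| "open_leaves (ImpE \<beta> D E) = (#) False ` open_leaves D \<union> (#) True ` open_leaves E"

text \<open>Requiring \<open>w\<close> to be open in the premiss gives priority to the innermost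
  matching introduction, so no leaf is discharged twice, even if a marker is reused. The bit
  \<open>False\<close> leads to the only premiss.\<close>

definition discharge :: "'p nd \<Rightarrow> (bool list \<times> bool list) set" where
  "discharge D = {(v @ False # w, v) | v w m \<alpha> \<beta> E. v \<in> positions D \<and>
     subderiv D v = ImpI m \<alpha> \<beta> E \<and> w \<in> open_leaves E \<and> subderiv E w = Assm m \<alpha>}"

lemma open_leaves_positions: "w \<in> open_leaves D \<Longrightarrow> w \<in> positions D"
  by (induction D arbitrary: w) auto

lemma open_leaves_assm: "w \<in> open_leaves D \<Longrightarrow> is_assm (subderiv D w)"
  by (induction D arbitrary: w) auto

lemma open_marked_open_leaves:
  "open_marked D = {(m, \<alpha>). \<exists>w \<in> open_leaves D. subderiv D w = Assm m \<alpha>}"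
  by (induction D) (auto simp: bex_Un)

lemma image_concl_open_leaves:
  "(\<lambda>w. concl (subderiv D w)) ` open_leaves D = snd ` open_marked D"
proof -
  have "\<exists>m \<alpha>. subderiv D w = Assm m \<alpha>" if "w \<in> open_leaves D" for w
    using open_leaves_assm[OF that] by (cases "subderiv D w") auto
  then show ?thesis
    by (force simp: open_marked_open_leaves image_iff)
qed

text \<open>Discharge at a position is determined by the subderivation there, so a common prefix
  cancels. This is the stability under passing to subderivations.\<close>

lemma discharge_append:
  assumes "p \<in> positions D"
  shows "(p @ u, p @ v) \<in> discharge D \<longleftrightarrow> (u, v) \<in> discharge (subderiv D p)"
  using assms by (auto simp: discharge_def append_in_positions_iff subderiv_append)

lemma discharge_Nil:
  "(u, []) \<in> discharge D \<longleftrightarrow> (\<exists>w m \<alpha> \<beta> E. u = False # w \<and> D = ImpI m \<alpha> \<beta> E \<and>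
     w \<in> open_leaves E \<and> subderiv E w = Assm m \<alpha>)"
  by (auto simp: discharge_def)

lemma discharge_Cons:
  "(u, b # v) \<in> discharge D \<longleftrightarrow>
     [b] \<in> positions D \<and> (\<exists>u'. u = b # u' \<and> (u', v) \<in> discharge (subderiv D [b]))"
proof
  assume "(u, b # v) \<in> discharge D"
  \<comment> \<open>The target of a discharge is a prefix of its source, so both lie in the same
    immediate subderivation.\<close>
  then obtain w where "u = b # v @ False # w" and "b # v \<in> positions D"
    by (auto simp: discharge_def)
  with \<open>(u, b # v) \<in> discharge D\<close>
  show "[b] \<in> positions D \<and> (\<exists>u'. u = b # u' \<and> (u', v) \<in> discharge (subderiv D [b]))"
    using append_in_positions_iff[of "[b]" v D] discharge_append[of "[b]" D "v @ False # w" v]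
    by simp
next
  assume "[b] \<in> positions D \<and> (\<exists>u'. u = b # u' \<and> (u', v) \<in> discharge (subderiv D [b]))"
  then show "(u, b # v) \<in> discharge D"
    using discharge_append[of "[b]" D _ v] by auto
qed

lemma ex_discharge_iff:
  "(\<exists>v. (u, v) \<in> discharge D) \<longleftrightarrow>
     (u, []) \<in> discharge D \<or> (\<exists>b v. (u, b # v) \<in> discharge D)"
  by (metis neq_Nil_conv)

text \<open>Matches the recursive notion of openness with the global one used for trees. A discharge
  happens either at the conclusion, where it removes exactly the leaves filtered out by the
  introduction, or inside a premiss, where the induction hypothesis applies.\<close>

lemma open_leaves_iff:
  "w \<in> open_leaves D \<longleftrightarrow>
     w \<in> positions D \<and> is_assm (subderiv D w) \<and> (\<nexists>v. (w, v) \<in> discharge D)"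
proof (induction D arbitrary: w)
  case (Assm m \<alpha>)
  then show ?case
    by (auto simp: ex_discharge_iff discharge_Nil discharge_Cons)
next
  case (ImpI m \<alpha> \<beta> D)
  then show ?case
    by (cases w) (auto simp: ex_discharge_iff[of _ "ImpI m \<alpha> \<beta> D"] discharge_Nil discharge_Cons)
next
  case (ImpE \<beta> D E)
  then show ?case
    by (cases w) (auto simp: ex_discharge_iff[of _ "ImpE \<beta> D E"] discharge_Nil discharge_Cons)
qed

section \<open>The tree of a derivation\<close>

text \<open>Positions are coded injectively as numbers, so that the type of nodes is
  \<open>nat\<close>; \<open>from_nat\<close> recovers them for the labelling.\<close>

abbreviation enc :: "bool list \<Rightarrow> nat" where
  "enc \<equiv> to_nat"

definition tree_of :: "'p nd \<Rightarrow> (nat, 'p) tree_deriv" where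
  "tree_of D = \<lparr>
     nodes = enc ` positions D,
     ded = {(enc (p @ [b]), enc p) | p b. p @ [b] \<in> positions D},
     dis = {(enc u, enc v) | u v. (u, v) \<in> discharge D},
     root = enc [],
     lbl = (\<lambda>n. concl (subderiv D (from_nat n)))\<rparr>"

lemma tree_of_simps [simp]:
  "nodes (tree_of D) = enc ` positions D"
  "root (tree_of D) = enc []"
  "lbl (tree_of D) (enc p) = concl (subderiv D p)"
  by (simp_all add: tree_of_def)

lemma ded_tree_of_iff:
  "(x, enc p) \<in> ded (tree_of D) \<longleftrightarrow> (\<exists>b. x = enc (p @ [b]) \<and> p @ [b] \<in> positions D)"
  by (auto simp: tree_of_def)

lemma ded_tree_ofE:
  assumes "(x, y) \<in> ded (tree_of D)"
  obtains p b where "x = enc (p @ [b])" "y = enc p" "p @ [b] \<in> positions D" "p \<in> positions D"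
  using assms append_in_positions_iff by (fastforce simp: tree_of_def)

lemma dis_tree_of_iff [simp]:
  "(enc u, enc v) \<in> dis (tree_of D) \<longleftrightarrow> (u, v) \<in> discharge D"
  by (auto simp: tree_of_def)

lemma dis_tree_ofE:
  assumes "(x, y) \<in> dis (tree_of D)"
  obtains v w m \<alpha> \<beta> E where "x = enc (v @ False # w)" "y = enc v" "v \<in> positions D"
    "subderiv D v = ImpI m \<alpha> \<beta> E" "w \<in> open_leaves E" "subderiv E w = Assm m \<alpha>"
    "v @ False # w \<in> positions D" "subderiv D (v @ False # w) = Assm m \<alpha>"
  using assms
  by (auto simp: tree_of_def discharge_def append_in_positions_iff subderiv_append
      open_leaves_positions)

section \<open>Premisses and degrees of nodes\<close>

lemma ded_tree_of_premisses:
  assumes "p \<in> positions D"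
  shows "{x. (x, enc p) \<in> ded (tree_of D)} =
    (case subderiv D p of
       Assm m \<alpha> \<Rightarrow> {}
     | ImpI m \<alpha> \<beta> E \<Rightarrow> {enc (p @ [False])}
     | ImpE \<beta> E F \<Rightarrow> {enc (p @ [False]), enc (p @ [True])})"
  using assms by (auto simp: ded_tree_of_iff append_in_positions_iff split: nd.split)

lemma indeg_tree_of:
  assumes "p \<in> positions D"
  shows "indeg (tree_of D) (enc p) =
    (case subderiv D p of Assm m \<alpha> \<Rightarrow> 0 | ImpI m \<alpha> \<beta> E \<Rightarrow> 1 | ImpE \<beta> E F \<Rightarrow> 2)"
  using assms by (simp add: indeg_def ded_tree_of_premisses split: nd.split)

lemma indeg_tree_of_eq_0_iff:
  "p \<in> positions D \<Longrightarrow> indeg (tree_of D) (enc p) = 0 \<longleftrightarrow> is_assm (subderiv D p)"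
  by (simp add: indeg_tree_of split: nd.split)

lemma indeg_tree_of_eq_1E:
  assumes "v \<in> nodes (tree_of D)" "indeg (tree_of D) v = 1"
  obtains p m \<alpha> \<beta> E where "v = enc p" "p \<in> positions D" "subderiv D p = ImpI m \<alpha> \<beta> E"
  using assms by (auto simp: indeg_tree_of split: nd.splits)

lemma indeg_tree_of_eq_2E:
  assumes "v \<in> nodes (tree_of D)" "indeg (tree_of D) v = 2"
  obtains p \<beta> E F where "v = enc p" "p \<in> positions D" "subderiv D p = ImpE \<beta> E F"
  using assms by (auto simp: indeg_tree_of split: nd.splits)

lemma outdeg_tree_of:
  assumes "p \<in> positions D"
  shows "outdeg (tree_of D) (enc p) = (if p = [] then 0 else 1)"
proof -
  \<comment> \<open>Moving to the conclusion of a rule drops the last bit of the path.\<close>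
  have "{x. (enc p, x) \<in> ded (tree_of D)} = (if p = [] then {} else {enc (butlast p)})"
    using assms by (cases p rule: rev_exhaust) (auto simp: tree_of_def)
  then show ?thesis
    by (simp add: outdeg_def)
qed

section \<open>Paths and subtrees\<close>

lemma acyclic_ded_tree_of: "acyclic (ded (tree_of D))"
proof -
  \<comment> \<open>Every edge shortens the position by one bit.\<close>
  have "(ded (tree_of D))\<inverse> \<subseteq> measure (\<lambda>n. length (from_nat n :: bool list))"
    by (auto simp: tree_of_def)
  then have "wf ((ded (tree_of D))\<inverse>)"
    using wf_subset wf_measure by blast
  then show ?thesis
    using wf_acyclic acyclic_converse by blast
qed

lemma ded_tree_of_rtrancl:
  "p @ q \<in> positions D \<Longrightarrow> (enc (p @ q), enc p) \<in> (ded (tree_of D))\<^sup>*"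
proof (induction q rule: rev_induct)
  case (snoc b q)
  then have "(enc (p @ q @ [b]), enc (p @ q)) \<in> ded (tree_of D)"
    by (simp add: ded_tree_of_iff)
  moreover have "p @ q \<in> positions D"
    using snoc.prems append_in_positions_iff[of "p @ q" "[b]" D] by simp
  ultimately show ?case
    using snoc.IH by (meson converse_rtrancl_into_rtrancl)
qed simp

lemma ded_tree_of_trancl:
  assumes "p @ b # q \<in> positions D"
  shows "(enc (p @ b # q), enc p) \<in> (ded (tree_of D))\<^sup>+"
proof -
  have "p @ [b] \<in> positions D"
    using assms append_in_positions_iff[of "p @ [b]" q D] by simp
  then have "(enc (p @ [b]), enc p) \<in> ded (tree_of D)"
    by (simp add: ded_tree_of_iff)
  then show ?thesis
    using ded_tree_of_rtrancl[of "p @ [b]" q D] assms by simp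
qed

lemma ded_tree_of_rtranclD:
  assumes "(x, enc p) \<in> (ded (tree_of D))\<^sup>*"
  shows "\<exists>q. x = enc (p @ q)"
  using assms
proof (induction rule: converse_rtrancl_induct)
  case base
  show ?case by (rule exI[of _ "[]"]) simp
next
  case (step x y)
  then show ?case by (auto simp: ded_tree_of_iff)
qed

lemma subtree_tree_of:
  assumes "p \<in> positions D"
  shows "subtree (tree_of D) (enc p) = (\<lambda>q. enc (p @ q)) ` positions (subderiv D p)"
  using assms
  by (auto simp: subtree_def append_in_positions_iff ded_tree_of_rtrancl
      dest!: ded_tree_of_rtranclD)

section \<open>Open occurrences, dependency sets and assumptions\<close>

lemma open_occs_tree_of:
  assumes "p \<in> positions D"
  shows "open_occs (tree_of D) (enc p) = (\<lambda>q. enc (p @ q)) ` open_leaves (subderiv D p)"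
proof -
  have "enc (p @ q) \<in> open_occs (tree_of D) (enc p) \<longleftrightarrow> q \<in> open_leaves (subderiv D p)"
    if q: "q \<in> positions (subderiv D p)" for q
  proof -
    \<comment> \<open>\<open>open_occs\<close> only considers discharges at nodes of the subtree.
      Targets of \<open>discharge\<close> are positions, so this restriction loses none of those in
      the subderivation.\<close>
    have "v \<in> positions (subderiv D p)" if "(q, v) \<in> discharge (subderiv D p)" for v
      using that by (auto simp: discharge_def)
    then show ?thesis
      using assms q
      by (auto simp: open_occs_def subtree_tree_of open_leaves_iff indeg_tree_of_eq_0_iff
          append_in_positions_iff subderiv_append discharge_append)
  qed
  moreover have "open_occs (tree_of D) (enc p) \<subseteq> (\<lambda>q. enc (p @ q)) ` positions (subderiv D p)"
    using subtree_tree_of[OF assms] by (auto simp: open_occs_def)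
  ultimately show ?thesis
    using open_leaves_positions by fast
qed

lemma depends_tree_of:
  assumes "p \<in> positions D"
  shows "depends (tree_of D) (enc p) = snd ` open_marked (subderiv D p)"
  using assms
  by (simp add: depends_def open_occs_tree_of image_image subderiv_append
      flip: image_concl_open_leaves)

lemma tree_assumptions_tree_of: "tree_assumptions (tree_of D) = snd ` open_marked D"
proof -
  \<comment> \<open>The left side ranges over all numbers, but only codes of positions are
    targets.\<close>
  have "(\<forall>y. (enc u, y) \<notin> dis (tree_of D)) \<longleftrightarrow> (\<forall>v. (u, v) \<notin> discharge D)" for u
    by (auto simp: tree_of_def)
  then have "{x \<in> nodes (tree_of D). indeg (tree_of D) x = 0 \<and> (\<nexists>y. (x, y) \<in> dis (tree_of D))} =
      enc ` open_leaves D"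
    by (auto simp: open_leaves_iff indeg_tree_of_eq_0_iff) blast
  then show ?thesis
    by (simp add: tree_assumptions_def image_image flip: image_concl_open_leaves)
qed

section \<open>Correctness and greediness of the tree\<close>

lemma tree_like_tree_of:
  assumes "nd_correct D"
  shows "tree_like (tree_of D)"
  unfolding tree_like_def
proof (intro conjI)
  let ?T = "tree_of D"
  show "finite (nodes ?T)" "root ?T \<in> nodes ?T"
    by simp_all
  show "ded ?T \<subseteq> nodes ?T \<times> nodes ?T"
    by (auto elim!: ded_tree_ofE)
  show "dis ?T \<subseteq> nodes ?T \<times> nodes ?T"
    by (auto elim!: dis_tree_ofE)
  show "acyclic (ded ?T)"
    by (rule acyclic_ded_tree_of)
  show "\<forall>u \<in> nodes ?T. \<forall>v \<in> nodes ?T. (u, v) \<in> (ded ?T \<union> (ded ?T)\<inverse>)\<^sup>*"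
  proof (intro ballI)
    fix u v
    assume "u \<in> nodes ?T" "v \<in> nodes ?T"
    \<comment> \<open>Connectedness: go down from \<open>u\<close> to the root, then back up to
      \<open>v\<close>.\<close>
    then have "(u, root ?T) \<in> (ded ?T)\<^sup>*" "(root ?T, v) \<in> ((ded ?T)\<inverse>)\<^sup>*"
      using ded_tree_of_rtrancl[of "[]" _ D] by (auto simp: rtrancl_converse)
    then show "(u, v) \<in> (ded ?T \<union> (ded ?T)\<inverse>)\<^sup>*"
      by (meson in_rtrancl_UnI rtrancl_trans)
  qed
  show "\<forall>v \<in> nodes ?T. outdeg ?T v = 0 \<longleftrightarrow> v = root ?T" "\<forall>v \<in> nodes ?T. outdeg ?T v \<le> 1"
    by (auto simp: outdeg_tree_of)
  show "\<forall>v \<in> nodes ?T. indeg ?T v \<in> {0, 1, 2}"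
    by (auto simp: indeg_tree_of split: nd.split)
  show "\<forall>v \<in> nodes ?T. indeg ?T v = 1 \<longrightarrow>
      (\<forall>w. (w, v) \<in> ded ?T \<longrightarrow>
         (\<exists>\<alpha>. lbl ?T v = \<alpha> \<^bold>\<rightarrow> lbl ?T w \<and> (\<forall>u. (u, v) \<in> dis ?T \<longrightarrow> lbl ?T u = \<alpha>)))"
  proof (intro ballI impI allI)
    fix v w
    assume v: "v \<in> nodes ?T" "indeg ?T v = 1" and w: "(w, v) \<in> ded ?T"
    from v obtain p m \<alpha> \<beta> E where p: "v = enc p" "p \<in> positions D"
      "subderiv D p = ImpI m \<alpha> \<beta> E"
      by (rule indeg_tree_of_eq_1E)
    have "w = enc (p @ [False])"
      using w p ded_tree_of_premisses[of p D] by auto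
    moreover have "concl E = \<beta>"
      using nd_correct_subderiv[OF assms p(2)] p(3) by simp
    moreover have "lbl ?T u = \<alpha>" if "(u, v) \<in> dis ?T" for u
      using that p by (auto elim: dis_tree_ofE)
    ultimately show "\<exists>\<alpha>. lbl ?T v = \<alpha> \<^bold>\<rightarrow> lbl ?T w \<and> (\<forall>u. (u, v) \<in> dis ?T \<longrightarrow> lbl ?T u = \<alpha>)"
      using p by (auto simp: subderiv_append)
  qed
  show "\<forall>u v. (u, v) \<in> dis ?T \<longrightarrow> (u, v) \<in> (ded ?T)\<^sup>+ \<and> indeg ?T u = 0 \<and> indeg ?T v = 1"
    by (auto elim!: dis_tree_ofE simp: ded_tree_of_trancl indeg_tree_of)
  show "\<forall>v \<in> nodes ?T. indeg ?T v = 2 \<longrightarrow>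
      (\<exists>w1 w2. {w. (w, v) \<in> ded ?T} = {w1, w2} \<and> lbl ?T w2 = lbl ?T w1 \<^bold>\<rightarrow> lbl ?T v)"
  proof (intro ballI impI)
    fix v
    assume "v \<in> nodes ?T" "indeg ?T v = 2"
    then obtain p \<beta> E F where p: "v = enc p" "p \<in> positions D" "subderiv D p = ImpE \<beta> E F"
      by (rule indeg_tree_of_eq_2E)
    \<comment> \<open>\<open>False\<close> leads to the minor and \<open>True\<close> to the major
      premiss, which fixes the roles of \<open>w1\<close> and \<open>w2\<close>.\<close>
    have "{w. (w, v) \<in> ded ?T} = {enc (p @ [False]), enc (p @ [True])}"
      using p by (simp add: ded_tree_of_premisses)
    moreover have "lbl ?T (enc (p @ [True])) = lbl ?T (enc (p @ [False])) \<^bold>\<rightarrow> lbl ?T v"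
      using nd_correct_subderiv[OF assms p(2)] p by (simp add: subderiv_append)
    ultimately show
      "\<exists>w1 w2. {w. (w, v) \<in> ded ?T} = {w1, w2} \<and> lbl ?T w2 = lbl ?T w1 \<^bold>\<rightarrow> lbl ?T v"
      by blast
  qed
qed

lemma tree_greedy_tree_of:
  assumes "nd_correct D" "nd_greedy D"
  shows "tree_greedy (tree_of D)"
  unfolding tree_greedy_def
proof (intro ballI allI impI, elim conjE)
  let ?T = "tree_of D"
  fix v w \<alpha> u
  assume v: "v \<in> nodes ?T" "indeg ?T v = 1" and w: "(w, v) \<in> ded ?T"
    and lv: "lbl ?T v = \<alpha> \<^bold>\<rightarrow> lbl ?T w" and u: "u \<in> open_occs ?T w" "lbl ?T u = \<alpha>"
  from v obtain p m \<alpha>' \<beta> E where p: "v = enc p" "p \<in> positions D"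
    "subderiv D p = ImpI m \<alpha>' \<beta> E"
    by (rule indeg_tree_of_eq_1E)
  have "w = enc (p @ [False])"
    using w p ded_tree_of_premisses[of p D] by auto
  moreover have pF: "p @ [False] \<in> positions D" "subderiv D (p @ [False]) = E"
    using p by (simp_all add: append_in_positions_iff subderiv_append)
  ultimately obtain q where q: "u = enc (p @ False # q)" "q \<in> open_leaves E"
    using u(1) by (auto simp: open_occs_tree_of)
  have "\<alpha>' = \<alpha>"
    using lv p by simp
  moreover have "concl (subderiv E q) = \<alpha>"
    using u(2) q(1) p by (simp add: subderiv_append)
  ultimately obtain m' where m': "subderiv E q = Assm m' \<alpha>'"
    using open_leaves_assm[OF q(2)] by (cases "subderiv E q") auto
  \<comment> \<open>The label of \<open>u\<close> determines its formula but not its marker.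
    Greediness of the derivation at \<open>p\<close> supplies the marker, and with it the discharge
    edge.\<close>
  then have "m' = m"
    using nd_greedy_subderiv[OF assms(2) p(2)] p(3) q(2)
    by (auto simp: open_marked_open_leaves)
  then show "(u, v) \<in> dis ?T"
    using p q m' by (auto simp: discharge_def)
qed

section \<open>Decorations\<close>

lemma bits_set_map_mem:
  assumes "A \<subseteq> set \<beta>s"
  shows "bits_set \<beta>s (map (\<lambda>\<beta>. \<beta> \<in> A) \<beta>s) = A"
  using assms by (fastforce simp: bits_set_def in_set_conv_nth)

lemma depends_subset_labels: "depends T v \<subseteq> lbl T ` nodes T"
  by (auto simp: depends_def open_occs_def subtree_def)

text \<open>Any greedy tree-like derivation can be decorated over any order of its labels: each edge
  gets the characteristic string of the dependency set of its source, which contains only labels of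
  nodes.\<close>

lemma dgtd_depends:
  assumes "tree_like T" "tree_greedy T" "linear_order_of \<beta>s (lbl T ` nodes T)"
  shows "dgtd \<beta>s T (\<lambda>e. map (\<lambda>\<beta>. \<beta> \<in> depends T (fst e)) \<beta>s)"
  using assms depends_subset_labels[of T]
  by (auto simp: dgtd_def linear_order_of_def bits_set_map_mem)

theorem theorem1:
  fixes D :: "'p nd" and \<alpha> :: "'p form" and \<Gamma> :: "'p form set"
  assumes "nd_derivation_of D \<alpha> \<Gamma>"
    and "nd_greedy D"
  shows "\<exists>T :: (nat, 'p) tree_deriv.
           tree_derivation_of T \<alpha> \<Gamma> \<and>
           (\<forall>\<beta>s. linear_order_of \<beta>s (lbl T ` nodes T) \<longrightarrow>
              (\<exists>L :: nat \<times> nat \<Rightarrow> bool list. dgtd \<beta>s T L))"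
proof -
  have D: "nd_correct D" "concl D = \<alpha>" "snd ` open_marked D = \<Gamma>"
    using assms(1) by (simp_all add: nd_derivation_of_def)
  have "tree_derivation_of (tree_of D) \<alpha> \<Gamma>"
    using D by (simp add: tree_derivation_of_def tree_like_tree_of tree_assumptions_tree_of)
  then show ?thesis
    \<comment> \<open>The tree is chosen before the order; only the decoration varies with
      it.\<close>
    using dgtd_depends tree_like_tree_of[OF D(1)] tree_greedy_tree_of[OF D(1) assms(2)] by blast
qed

end
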